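(* Let $n\geq 2$ and let $R_n$ be the Cayley graph on $\mathbb{Z}_{2n}\times\mathbb{Z}_4$ with connection set $$S=\{(0,1),(0,3),(n,0),(n,2),(2i,2),(2i+1,0)\mid 0\leq i\leq n-1\}.$$ Then $R_n$ is a connected CIS graph of order $8n$ and valency $2n+3$ with $\alpha(R_n)=2n$ and $\omega(R_n)=4$.
   Context: For a group $G$ (written additively here) and an inverse-closed subset $S\subseteq G$ not containing the identity, the Cayley graph on $G$ with connection set $S$ has vertex set $G$, with $g,h$ adjacent if and only if $h-g\in S$. A clique (respectively, stable set) is a set of pairwise adjacent (respectively, pairwise non-adjacent) vertices; "maximal" means maximal with respect to inclusion. $\omega(\Gamma)$ and $\alpha(\Gamma)$ denote the largest cardinality of a clique and of a stable set of $\Gamma$. A graph is CIS if every maximal stable set and every maximal clique have non-empty intersection. A graph has valency $k$ if every vertex has exactly $k$ neighbors; the order is the number of vertices. *)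

theory Defs
  imports
    "HOL-Algebra.Elementary_Groups"
    "Graph_Theory.Digraph_Component"
begin

text \<open>
  A finite simple graph is a \<open>pair_graph\<close>: a finite, loop-free, symmetric digraph without
  parallel arcs.
\<close>

definition clique :: "('a, 'b) pre_digraph \<Rightarrow> 'a set \<Rightarrow> bool" where
  "clique G C \<longleftrightarrow> C \<subseteq> verts G \<and> (\<forall>u\<in>C. \<forall>v\<in>C. u \<noteq> v \<longrightarrow> u \<rightarrow>\<^bsub>G\<^esub> v)"

definition stable_set :: "('a, 'b) pre_digraph \<Rightarrow> 'a set \<Rightarrow> bool" where
  "stable_set G A \<longleftrightarrow> A \<subseteq> verts G \<and> (\<forall>u\<in>A. \<forall>v\<in>A. u \<noteq> v \<longrightarrow> \<not> (u \<rightarrow>\<^bsub>G\<^esub> v))"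

definition maximal_clique :: "('a, 'b) pre_digraph \<Rightarrow> 'a set \<Rightarrow> bool" where
  "maximal_clique G C \<longleftrightarrow> clique G C \<and> \<not> (\<exists>D. clique G D \<and> C \<subset> D)"

definition maximal_stable_set :: "('a, 'b) pre_digraph \<Rightarrow> 'a set \<Rightarrow> bool" where
  "maximal_stable_set G A \<longleftrightarrow> stable_set G A \<and> \<not> (\<exists>B. stable_set G B \<and> A \<subset> B)"

definition CIS :: "('a, 'b) pre_digraph \<Rightarrow> bool" where
  "CIS G \<longleftrightarrow> (\<forall>A C. maximal_stable_set G A \<and> maximal_clique G C \<longrightarrow> A \<inter> C \<noteq> {})"

text \<open>The next two definitions are meaningful only when the vertex set is finite.\<close>

definition clique_number :: "('a, 'b) pre_digraph \<Rightarrow> nat" where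
  "clique_number G = Max {card C | C. clique G C}"

definition stability_number :: "('a, 'b) pre_digraph \<Rightarrow> nat" where
  "stability_number G = Max {card A | A. stable_set G A}"

text \<open>A set of neighbours rather than of arcs, so that parallel arcs would not be counted twice.\<close>

definition has_valency :: "('a, 'b) pre_digraph \<Rightarrow> nat \<Rightarrow> bool" where
  "has_valency G k \<longleftrightarrow> (\<forall>v\<in>verts G. card {w \<in> verts G. v \<rightarrow>\<^bsub>G\<^esub> w} = k)"

text \<open>
  The difference \<open>h - g\<close> is \<open>h \<otimes> inv g\<close> in multiplicative notation. The result is a simple
  graph when \<open>S\<close> is inverse-closed and does not contain the identity.
\<close>

definition cayley_graph :: "('a, 'm) monoid_scheme \<Rightarrow> 'a set \<Rightarrow> 'a pair_pre_digraph" where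
  "cayley_graph G S =
    \<lparr> pverts = carrier G,
      parcs = {(g, h). g \<in> carrier G \<and> h \<in> carrier G \<and> h \<otimes>\<^bsub>G\<^esub> inv\<^bsub>G\<^esub> g \<in> S} \<rparr>"

text \<open>
  Elements of \<open>integer_mod_group m\<close> are the representatives \<open>0, \<dots>, m - 1\<close>; for \<open>n \<ge> 1\<close> all the
  pairs below are reduced, so no \<open>mod\<close> is needed.
\<close>

definition R_conn :: "nat \<Rightarrow> (int \<times> int) set" where
  "R_conn n =
    {(0, 1), (0, 3), (int n, 0), (int n, 2)}
    \<union> {(2 * i, 2) | i. 0 \<le> i \<and> i \<le> int n - 1}
    \<union> {(2 * i + 1, 0) | i. 0 \<le> i \<and> i \<le> int n - 1}"

definition R_graph :: "nat \<Rightarrow> (int \<times> int) pair_pre_digraph" where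
  "R_graph n = cayley_graph (integer_mod_group (2 * n) \<times>\<times> integer_mod_group 4) (R_conn n)"

end

theory Submission
  imports Defs
begin

text \<open>
  Give the vertex \<open>(a, b)\<close> of \<open>R_graph n\<close> the column \<open>a\<close>, the side \<open>b mod 2\<close> and the half
  \<open>(a + b div 2) mod 2\<close>; these determine it. Vertices on different sides are adjacent iff they lie
  in the same column. Vertices on the same side are adjacent iff they lie in different halves or
  their columns differ by \<open>n\<close>.

  A clique therefore lies in a full column, or in the union of two matching edges
  \<open>{a, a + n}\<close>, one from each half of one side; both have four vertices. A stable set meets each
  column at most once and stays in one half per side. The two halves it uses induce a disjoint
  union of 4-cycles, and a maximal stable set of a 4-cycle meets each of its edges; since every
  maximal clique contains such an edge, the graph is CIS.
\<close>

text \<open>\<open>vtx a s h\<close> is the vertex in column \<open>a\<close>, on side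
  \<open>s\<close>, in half \<open>h\<close>, and \<open>\<tau>\<close> is the matching of columns.
  \<open>T\<close> picks one column from each matched pair: this rules out fixed points of
  \<open>\<tau>\<close> and yields a stable set with a vertex in every column.\<close>

locale matched_columns =
  fixes G :: "'v pair_pre_digraph"
    and A T :: "'c set"
    and \<tau> :: "'c \<Rightarrow> 'c"
    and vtx :: "'c \<Rightarrow> bool \<Rightarrow> bool \<Rightarrow> 'v"
  assumes finite_A: "finite A"
    and A_nonempty: "A \<noteq> {}"
    and \<tau>_closed [simp]: "a \<in> A \<Longrightarrow> \<tau> a \<in> A"
    and \<tau>_\<tau> [simp]: "a \<in> A \<Longrightarrow> \<tau> (\<tau> a) = a"
    and \<tau>_T: "a \<in> A \<Longrightarrow> \<tau> a \<in> T \<longleftrightarrow> a \<notin> T"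
    and pverts_eq: "pverts G = {vtx a s h | a s h. a \<in> A}"
    and parcs_sub: "parcs G \<subseteq> pverts G \<times> pverts G"
    and vtx_eq [simp]: "\<lbrakk>a \<in> A; a' \<in> A\<rbrakk> \<Longrightarrow>
      vtx a s h = vtx a' s' h' \<longleftrightarrow> a = a' \<and> s = s' \<and> h = h'"
    and adj [simp]: "\<lbrakk>a \<in> A; a' \<in> A\<rbrakk> \<Longrightarrow>
      (vtx a s h, vtx a' s' h') \<in> parcs G \<longleftrightarrow>
      (if s = s' then h \<noteq> h' \<or> a' = \<tau> a else a = a')"
begin

section \<open>Simplicity, order, connectedness and valency\<close>

lemma \<tau>_neq [simp]: "a \<in> A \<Longrightarrow> \<tau> a \<noteq> a" "a \<in> A \<Longrightarrow> a \<noteq> \<tau> a"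
  using \<tau>_T by metis+

lemma vtx_in_pverts [simp]: "a \<in> A \<Longrightarrow> vtx a s h \<in> pverts G"
  using pverts_eq by auto

lemma pverts_cases:
  assumes "u \<in> pverts G"
  obtains a s h where "a \<in> A" "u = vtx a s h"
  using assms pverts_eq by auto

lemma pverts_image: "pverts G = (\<lambda>(a, s, h). vtx a s h) ` (A \<times> UNIV \<times> UNIV)"
  by (auto simp: pverts_eq image_iff Bex_def) blast

lemma finite_pverts: "finite (pverts G)"
  unfolding pverts_image using finite_A by simp

lemma card_pverts: "card (pverts G) = 4 * card A"
proof -
  have "inj_on (\<lambda>(a, s, h). vtx a s h) (A \<times> UNIV \<times> UNIV)"
    by (auto simp: inj_on_def)
  then show ?thesis
    unfolding pverts_image
    by (simp add: card_image card_cartesian_product flip: UNIV_Times_UNIV)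
qed

lemma parcs_cases:
  assumes "(u, v) \<in> parcs G"
  obtains a s h a' s' h' where "a \<in> A" "u = vtx a s h" "a' \<in> A" "v = vtx a' s' h'"
  using assms parcs_sub by (metis SigmaD1 SigmaD2 subsetD pverts_cases)

lemma parcs_sym: "(u, v) \<in> parcs G \<Longrightarrow> (v, u) \<in> parcs G"
  by (frule parcs_sub[THEN subsetD]) (auto simp: pverts_eq split: if_splits)

lemma pair_graph: "pair_graph G"
proof unfold_locales
  show "finite (parcs G)"
    using finite_subset[OF parcs_sub] finite_pverts by blast
  show "symmetric (with_proj G)"
    by (auto simp: symmetric_def intro: symI parcs_sym)
  show "fst e \<noteq> snd e" if "e \<in> parcs G" for e
  proof -
    from that have "(fst e, snd e) \<in> parcs G" by simp
    then obtain a s h a' s' h' where "a \<in> A" "fst e = vtx a s h" "a' \<in> A" "snd e = vtx a' s' h'"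
      by (rule parcs_cases)
    with \<open>(fst e, snd e) \<in> parcs G\<close> show ?thesis by (auto split: if_splits)
  qed
qed (use parcs_sub finite_pverts in auto)

lemma connected: "Digraph_Component.connected (with_proj G)"
proof -
  interpret pair_graph G by (rule pair_graph)
  have step: "vtx a s h \<rightarrow>\<^sup>*\<^bsub>G\<^esub> vtx a' s (\<not> h)" if "a \<in> A" "a' \<in> A" for a a' s h
    using that by (intro reachable_adjI) simp
  have "u \<rightarrow>\<^sup>*\<^bsub>G\<^esub> v" if uv: "u \<in> pverts G" "v \<in> pverts G" for u v
  proof -
    obtain a s h a' s' h' where u: "a \<in> A" "u = vtx a s h" and v: "a' \<in> A" "v = vtx a' s' h'"
      using uv by (metis pverts_cases)
    \<comment> \<open>This vertex shares the column of \<open>u\<close> and lies on the side of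
      \<open>v\<close> in the other half, so it equals or neighbours \<open>u\<close>, and it
      neighbours \<open>v\<close>.\<close>
    have "u \<rightarrow>\<^sup>*\<^bsub>G\<^esub> vtx a s' (\<not> h')"
    proof (cases "s = s'")
      case True
      then show ?thesis using u step[of a a s h] by (cases "h = h'") auto
    next
      case False
      then show ?thesis using u by (intro reachable_adjI) simp
    qed
    also have "vtx a s' (\<not> h') \<rightarrow>\<^sup>*\<^bsub>G\<^esub> v"
      using step[of a a' s' "\<not> h'"] u v by simp
    finally show ?thesis .
  qed
  moreover have "pverts G \<noteq> {}"
    using A_nonempty by (auto simp: pverts_eq)
  moreover have "(parcs G)\<^sup>s = parcs G"
    using parcs_sym by (auto simp: symcl_def)
  ultimately show ?thesis
    by (auto simp: connected_conv reachable_def)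
qed

lemma has_valency: "has_valency (with_proj G) (card A + 3)"
  unfolding has_valency_def with_proj_simps
proof
  fix v assume "v \<in> pverts G"
  then obtain a s h where v: "a \<in> A" "v = vtx a s h" by (rule pverts_cases)
  \<comment> \<open>\<open>?N\<close> is the opposite half of the same side, one vertex per column;
    \<open>?M\<close> is the matching partner and the two vertices of the same column on the other
    side.\<close>
  let ?N = "(\<lambda>c. vtx c s (\<not> h)) ` A"
  let ?M = "{vtx (\<tau> a) s h, vtx a (\<not> s) True, vtx a (\<not> s) False}"
  have "{w \<in> pverts G. (v, w) \<in> parcs G} = ?N \<union> ?M"
  proof (intro equalityI subsetI)
    fix w assume w: "w \<in> {w \<in> pverts G. (v, w) \<in> parcs G}"
    then obtain c s' h' where c: "c \<in> A" "w = vtx c s' h'" by (blast elim: pverts_cases)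
    with w v show "w \<in> ?N \<union> ?M"
      by (cases "s' = s"; cases "h' = h"; cases h') auto
  qed (use v in auto)
  moreover have "card ?N = card A"
    by (rule card_image) (auto simp: inj_on_def)
  moreover have "card ?M = 3"
    using v by simp
  moreover have "?N \<inter> ?M = {}"
    using v by auto
  ultimately show "card {w \<in> pverts G. (v, w) \<in> parcs G} = card A + 3"
    using finite_A card_Un_disjoint[of ?N ?M] by auto
qed

section \<open>Cliques and the clique number\<close>

definition column :: "'c \<Rightarrow> 'v set" where
  "column a = {vtx a s h | s h. True}"

text \<open>\<open>p\<close> selects one matching edge in each half of side \<open>s\<close>; since
  the two halves are completely joined, the two edges span a complete graph.\<close>

definition edge_pair :: "bool \<Rightarrow> (bool \<Rightarrow> 'c) \<Rightarrow> 'v set" where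
  "edge_pair s p = {vtx c s h | c h. c \<in> {p h, \<tau> (p h)}}"

lemma clique_column: "a \<in> A \<Longrightarrow> clique (with_proj G) (column a)"
  by (auto simp: clique_def column_def)

lemma clique_edge_pair:
  assumes "\<And>h. p h \<in> A"
  shows "clique (with_proj G) (edge_pair s p)"
proof -
  have "(vtx c s h, vtx c' s h') \<in> parcs G"
    if "c \<in> {p h, \<tau> (p h)}" "c' \<in> {p h', \<tau> (p h')}" "vtx c s h \<noteq> vtx c' s h'" for c c' h h'
    using that assms by (cases "h = h'") auto
  then show ?thesis
    unfolding clique_def edge_pair_def using assms by auto
qed

lemma card_column: "a \<in> A \<Longrightarrow> card (column a) = 4"
proof -
  assume "a \<in> A"
  have "column a = {vtx a True True, vtx a True False, vtx a False True, vtx a False False}"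
    unfolding column_def by (auto; metis (full_types))
  with \<open>a \<in> A\<close> show ?thesis by simp
qed

lemma card_edge_pair:
  assumes "\<And>h. p h \<in> A"
  shows "card (edge_pair s p) = 4"
proof -
  have "edge_pair s p = {vtx (p True) s True, vtx (\<tau> (p True)) s True,
      vtx (p False) s False, vtx (\<tau> (p False)) s False}"
    unfolding edge_pair_def by (auto; metis (full_types))
  with assms show ?thesis by simp
qed

text \<open>Adjacency across sides forces equal columns, so a clique meeting both sides lies in one
  column. On a single side, adjacency within a half means being matched, so each half contributes at
  most one matching edge.\<close>

lemma clique_cases:
  assumes C: "clique (with_proj G) C"
  obtains (column) a where "a \<in> A" "C \<subseteq> column a"
    | (edge_pair) s p where "\<And>h. p h \<in> A" "C \<subseteq> edge_pair s p"
proof (cases "\<exists>a\<in>A. \<exists>a'\<in>A. \<exists>h h'. vtx a True h \<in> C \<and> vtx a' False h' \<in> C")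
  case True
  then obtain a a' h h' where *: "a \<in> A" "a' \<in> A" "vtx a True h \<in> C" "vtx a' False h' \<in> C"
    by blast
  have adjC: "(u, v) \<in> parcs G" if "u \<in> C" "v \<in> C" "u \<noteq> v" for u v
    using C that by (auto simp: clique_def)
  have "a' = a" using adjC[OF *(3,4)] * by simp
  have "C \<subseteq> column a"
  proof
    fix w assume w: "w \<in> C"
    with C have "w \<in> pverts G" by (auto simp: clique_def)
    then obtain c s k where c: "c \<in> A" "w = vtx c s k" by (rule pverts_cases)
    \<comment> \<open>Whichever side \<open>w\<close> is on, one of the two chosen vertices lies on
      the other side and must share its column.\<close>
    have "c = a"
      using adjC[OF w *(3)] adjC[OF w *(4)] * c \<open>a' = a\<close> by (cases s) auto
    with c show "w \<in> column a" by (auto simp: column_def)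
  qed
  with * show thesis by (intro column)
next
  case False
  have CV: "\<exists>c s k. c \<in> A \<and> w = vtx c s k" if "w \<in> C" for w
    using C that pverts_cases unfolding clique_def with_proj_simps by (metis subsetD)
  obtain s where s: "\<And>c s' k. \<lbrakk>c \<in> A; vtx c s' k \<in> C\<rbrakk> \<Longrightarrow> s' = s"
    using False by (metis (full_types))
  obtain a0 where a0: "a0 \<in> A" using A_nonempty by blast
  \<comment> \<open>\<open>p h\<close> is a column that \<open>C\<close> occupies in half
    \<open>h\<close>; the default \<open>a0\<close> serves a half that \<open>C\<close>
    misses.\<close>
  define p where "p h = (if \<exists>c\<in>A. vtx c s h \<in> C then SOME c. c \<in> A \<and> vtx c s h \<in> C else a0)" for h
  have p: "p h \<in> A \<and> ((\<exists>c\<in>A. vtx c s h \<in> C) \<longrightarrow> vtx (p h) s h \<in> C)" for h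
    using a0 someI_ex[of "\<lambda>c. c \<in> A \<and> vtx c s h \<in> C"] by (auto simp: p_def)
  have "C \<subseteq> edge_pair s p"
  proof
    fix w assume w: "w \<in> C"
    then obtain c s' k where "c \<in> A" "w = vtx c s' k" using CV by blast
    moreover from this have "s' = s" using s w by blast
    ultimately have c: "c \<in> A" "w = vtx c s k" by simp_all
    with w p[of k] have pk: "p k \<in> A" "vtx (p k) s k \<in> C" by auto
    have "vtx (p k) s k = w \<or> (vtx (p k) s k, w) \<in> parcs G"
      using C w pk by (auto simp: clique_def)
    then have "c = p k \<or> c = \<tau> (p k)"
      using c pk by auto
    then show "w \<in> edge_pair s p" using c by (auto simp: edge_pair_def)
  qed
  with p show thesis by (intro edge_pair) auto
qed

lemma clique_number: "clique_number (with_proj G) = 4"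
  unfolding clique_number_def
proof (rule Max_eqI)
  have "card C \<le> 4" if "clique (with_proj G) C" for C
    using that
  proof (cases rule: clique_cases)
    case (column a)
    \<comment> \<open>Infinite sets have \<open>card\<close> 0, so the value 4 also supplies the
      finiteness needed for monotonicity.\<close>
    then show ?thesis using card_column[of a] card_mono[of "column a" C]
      by (metis card.infinite zero_neq_numeral)
  next
    case (edge_pair s p)
    then show ?thesis using card_edge_pair[of p s] card_mono[of "edge_pair s p" C]
      by (metis card.infinite zero_neq_numeral)
  qed
  then show "y \<le> 4" if "y \<in> {card C | C. clique (with_proj G) C}" for y
    using that by auto
  then show "finite {card C | C. clique (with_proj G) C}"
    by (meson finite_nat_set_iff_bounded_le)
  obtain a where "a \<in> A" using A_nonempty by blast
  then show "4 \<in> {card C | C. clique (with_proj G) C}"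
    using clique_column card_column by force
qed

section \<open>Stable sets and the stability number\<close>

lemma card_stable_set_le:
  assumes "stable_set (with_proj G) B"
  shows "card B \<le> card A"
proof -
  have "\<forall>u\<in>B. \<exists>a\<in>A. \<exists>s h. u = vtx a s h"
    using assms by (auto simp: stable_set_def pverts_eq)
  then obtain col where col: "\<And>u. u \<in> B \<Longrightarrow> col u \<in> A \<and> (\<exists>s h. u = vtx (col u) s h)"
    by metis
  \<comment> \<open>Each column is a clique, so \<open>B\<close> has at most one vertex in
    it.\<close>
  have "inj_on col B"
  proof (rule inj_onI)
    fix u v assume uv: "u \<in> B" "v \<in> B" "col u = col v"
    then obtain a s h s' h' where *: "a \<in> A" "u = vtx a s h" "v = vtx a s' h'"
      using col by metis
    moreover have "u = v \<or> (u, v) \<notin> parcs G"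
      using assms uv by (auto simp: stable_set_def)
    ultimately show "u = v" by (auto split: if_splits)
  qed
  moreover have "col ` B \<subseteq> A" using col by auto
  ultimately show ?thesis using finite_A card_inj_on_le by blast
qed

lemma stability_number: "stability_number (with_proj G) = card A"
  unfolding stability_number_def
proof (rule Max_eqI)
  show "y \<le> card A" if "y \<in> {card B | B. stable_set (with_proj G) B}" for y
    using that card_stable_set_le by auto
  then show "finite {card B | B. stable_set (with_proj G) B}"
    by (meson finite_nat_set_iff_bounded_le)
  \<comment> \<open>One vertex per column, all in half \<open>False\<close>; matched columns are
    placed on opposite sides by \<open>T\<close>, so no matching edge occurs.\<close>
  let ?B = "(\<lambda>a. vtx a (a \<in> T) False) ` A"
  have "stable_set (with_proj G) ?B"
    using \<tau>_T by (auto simp: stable_set_def split: if_splits)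
  moreover have "card ?B = card A"
    by (rule card_image) (auto simp: inj_on_def)
  ultimately show "card A \<in> {card B | B. stable_set (with_proj G) B}"
    by force
qed

section \<open>The CIS property\<close>

lemma maximal_clique_cases:
  assumes "maximal_clique (with_proj G) C"
  obtains (column) a where "a \<in> A" "C = column a"
    | (edge_pair) s p where "\<And>h. p h \<in> A" "C = edge_pair s p"
proof -
  have C: "clique (with_proj G) C" and max: "\<And>D. clique (with_proj G) D \<Longrightarrow> C \<subseteq> D \<Longrightarrow> C = D"
    using assms by (auto simp: maximal_clique_def)
  show thesis
    using C
  proof (cases rule: clique_cases)
    case (column a)
    then show thesis using max clique_column that(1) by blast
  next
    case (edge_pair s p)
    then show thesis using max clique_edge_pair that(2) by blast
  qed
qed

text \<open>Maximal stable sets are dominating: an outside vertex without a neighbour in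
  \<open>B\<close> could be added.\<close>

lemma maximal_stable_set_neighbour:
  assumes "maximal_stable_set (with_proj G) B" "u \<in> pverts G" "u \<notin> B"
  obtains v where "v \<in> B" "(u, v) \<in> parcs G"
proof -
  have "\<not> stable_set (with_proj G) (insert u B)"
    using assms by (auto simp: maximal_stable_set_def)
  moreover have "stable_set (with_proj G) B"
    using assms by (auto simp: maximal_stable_set_def)
  ultimately show thesis
    using assms(2) that parcs_sym by (auto simp: stable_set_def)
qed

lemma CIS: "CIS (with_proj G)"
  unfolding CIS_def
proof (intro allI impI notI)
  fix B C
  assume BC: "maximal_stable_set (with_proj G) B \<and> maximal_clique (with_proj G) C"
    and disj: "B \<inter> C = {}"
  have nadj: "(u, v) \<notin> parcs G" if "u \<in> B" "v \<in> B" "u \<noteq> v" for u v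
    using BC that by (auto simp: maximal_stable_set_def stable_set_def)
  \<comment> \<open>The two halves of a side are completely joined, so \<open>B\<close> uses at most
    one of them; on a side that \<open>B\<close> misses, \<open>\<eta>\<close> is arbitrary.\<close>
  have "\<exists>\<eta>. \<forall>a\<in>A. \<forall>h. vtx a s h \<in> B \<longrightarrow> h = \<eta>" for s
  proof -
    have "h = h'" if "a \<in> A" "a' \<in> A" "vtx a s h \<in> B" "vtx a' s h' \<in> B" for a a' h h'
      using nadj[OF that(3,4)] that by auto
    then show ?thesis by meson
  qed
  then obtain \<eta> where \<eta>: "\<And>s a h. \<lbrakk>a \<in> A; vtx a s h \<in> B\<rbrakk> \<Longrightarrow> h = \<eta> s"
    by metis
  \<comment> \<open>Inside the chosen halves a vertex has only two neighbours, its matching partner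
    and one vertex of its column; domination puts one of them in \<open>B\<close>.\<close>
  have nbr: "vtx (\<tau> a) s (\<eta> s) \<in> B \<or> vtx a (\<not> s) (\<eta> (\<not> s)) \<in> B"
    if a: "a \<in> A" "vtx a s (\<eta> s) \<notin> B" for a s
  proof -
    obtain v where v: "v \<in> B" "(vtx a s (\<eta> s), v) \<in> parcs G"
      using maximal_stable_set_neighbour BC a vtx_in_pverts by metis
    moreover obtain c s' h where "c \<in> A" "v = vtx c s' h"
      using v(2) parcs_cases by metis
    moreover from this have "h = \<eta> s'" using \<eta> v by blast
    ultimately show ?thesis
      using \<open>a \<in> A\<close> by (cases "s' = s") (auto split: if_splits)
  qed
  from BC have "maximal_clique (with_proj G) C" by simp
  then show False
  proof (cases rule: maximal_clique_cases)
    case (column a)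
    then have "vtx a s (\<eta> s) \<notin> B" for s
      using disj by (auto simp: column_def)
    \<comment> \<open>With both chosen vertices of column \<open>a\<close> missing from
      \<open>B\<close>, each is dominated by its partner; but the two partners share column
      \<open>\<tau> a\<close>.\<close>
    then have "vtx (\<tau> a) s (\<eta> s) \<in> B" for s
      using nbr column by blast
    from nadj[OF this[of True] this[of False]] show False
      using column by simp
  next
    case (edge_pair s p)
    \<comment> \<open>The matching edge of \<open>C\<close> in the half \<open>\<eta> s\<close>
      avoids \<open>B\<close>, so both its ends are dominated from the other side, by two vertices
      that are themselves matched.\<close>
    define a where "a = p (\<eta> s)"
    have a: "a \<in> A" "vtx a s (\<eta> s) \<notin> B" "vtx (\<tau> a) s (\<eta> s) \<notin> B"
      using edge_pair disj by (auto simp: edge_pair_def a_def)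
    then have "vtx a (\<not> s) (\<eta> (\<not> s)) \<in> B" "vtx (\<tau> a) (\<not> s) (\<eta> (\<not> s)) \<in> B"
      using nbr[of a s] nbr[of "\<tau> a" s] by auto
    from nadj[OF this] show False
      using a by simp
  qed
qed

end

section \<open>The Cayley graph in column, side and half coordinates\<close>

lemma R_conn_iff:
  assumes "0 \<le> x" "x < 2 * int n" "0 \<le> y" "y < 4"
  shows "(x, y) \<in> R_conn n \<longleftrightarrow> (if odd y then x = 0 else odd (x + y div 2) \<or> x = int n)"
proof -
  \<comment> \<open>The family with \<open>y = 2\<close> covers the even \<open>x\<close>, the one
    with \<open>y = 0\<close> the odd \<open>x\<close>; both amount to \<open>x + y div 2\<close>
    being odd.\<close>
  have ev: "(\<exists>i. x = 2 * i \<and> 0 \<le> i \<and> i \<le> int n - 1) \<longleftrightarrow> even x"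
    using assms by presburger
  have od: "(\<exists>i. x = 2 * i + 1 \<and> 0 \<le> i \<and> i \<le> int n - 1) \<longleftrightarrow> odd x"
    using assms by presburger
  have "y = 0 \<or> y = 1 \<or> y = 2 \<or> y = 3" using assms by arith
  then show ?thesis
    using ev od by (auto simp: R_conn_def)
qed

lemma pverts_R_graph: "n \<ge> 1 \<Longrightarrow> pverts (R_graph n) = {0..<2 * int n} \<times> {0..<4}"
  by (simp add: R_graph_def cayley_graph_def carrier_integer_mod_group)

lemma parcs_R_graph:
  assumes "n \<ge> 1" "(a, b) \<in> pverts (R_graph n)" "(c, d) \<in> pverts (R_graph n)"
  shows "((a, b), (c, d)) \<in> parcs (R_graph n) \<longleftrightarrow>
    ((c - a) mod (2 * int n), (d - b) mod 4) \<in> R_conn n"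
  using assms
  by (simp add: R_graph_def cayley_graph_def carrier_integer_mod_group mod_add_right_eq)

text \<open>The second coordinate \<open>b\<close> is recovered from its parity \<open>s\<close> and
  from \<open>b div 2\<close>, obtained by solving \<open>h = (a + b div 2) mod 2\<close>.\<close>

definition R_vertex :: "int \<Rightarrow> bool \<Rightarrow> bool \<Rightarrow> int \<times> int" where
  "R_vertex a s h = (a, of_bool s + 2 * ((a + of_bool h) mod 2))"

lemma mod_eq_iff_diff:
  fixes a c m n :: int
  assumes "0 \<le> a" "a < m" "0 \<le> c" "c < m" "0 \<le> n" "n < m"
  shows "(c - a) mod m = n \<longleftrightarrow> c = (a + n) mod m"
proof
  assume "(c - a) mod m = n"
  then have "(a + n) mod m = (a + (c - a)) mod m" by (metis mod_add_right_eq)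
  then show "c = (a + n) mod m" using assms by simp
next
  assume "c = (a + n) mod m"
  then have "(c - a) mod m = (a + n - a) mod m" by (metis mod_diff_left_eq)
  then show "(c - a) mod m = n" using assms by simp
qed

lemma R_vertex_adj:
  assumes n: "n \<ge> 1" and a: "a \<in> {0..<2 * int n}" and c: "c \<in> {0..<2 * int n}"
  shows "(R_vertex a s h, R_vertex c s' h') \<in> parcs (R_graph n) \<longleftrightarrow>
    (if s = s' then h \<noteq> h' \<or> c = (a + int n) mod (2 * int n) else a = c)"
proof -
  define x where "x = (c - a) mod (2 * int n)"
  define y where "y = (of_bool s' + 2 * ((c + of_bool h') mod 2) - (of_bool s + 2 * ((a + of_bool h) mod 2))) mod (4::int)"
  have V: "R_vertex a s h \<in> pverts (R_graph n)" "R_vertex c s' h' \<in> pverts (R_graph n)"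
    using a c n by (auto simp: R_vertex_def pverts_R_graph)
  have x: "0 \<le> x" "x < 2 * int n" using n by (auto simp: x_def)
  have y: "0 \<le> y" "y < 4" by (auto simp: y_def)
  have adj: "(R_vertex a s h, R_vertex c s' h') \<in> parcs (R_graph n) \<longleftrightarrow> (x, y) \<in> R_conn n"
    using parcs_R_graph[OF n] V by (simp add: R_vertex_def x_def y_def)
  have x0: "x = 0 \<longleftrightarrow> a = c"
    using mod_eq_iff_diff[of a "2 * int n" c 0] a c n by (auto simp: x_def)
  have xn: "x = int n \<longleftrightarrow> c = (a + int n) mod (2 * int n)"
    using mod_eq_iff_diff[of a "2 * int n" c "int n"] a c n by (auto simp: x_def)
  \<comment> \<open>Reduction modulo the even number \<open>2 * int n\<close> preserves
    parity.\<close>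
  have px: "even x \<longleftrightarrow> even (c - a)"
    unfolding x_def by (simp add: dvd_mod_iff)
  have py: "even y \<longleftrightarrow> s = s'"
  proof -
    have "even (z mod 4) \<longleftrightarrow> even z" for z :: int by presburger
    then show ?thesis unfolding y_def by auto
  qed
  \<comment> \<open>Modulo 2, \<open>y div 2\<close> is \<open>c - a\<close> plus the difference of
    the halves. Adding \<open>x\<close>, which has the parity of \<open>c - a\<close>, leaves
    exactly the condition \<open>h \<noteq> h'\<close>.\<close>
  have pq: "odd (y div 2) \<longleftrightarrow> (even (a + c) \<longleftrightarrow> h \<noteq> h')" if "s = s'"
  proof -
    have "y = (2 * ((c + of_bool h') mod 2 - (a + of_bool h) mod 2)) mod 4"
      using that by (simp add: y_def algebra_simps)
    moreover have "odd ((2 * z) mod 4 div 2) \<longleftrightarrow> odd z" for z :: int by presburger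
    ultimately have "odd (y div 2) \<longleftrightarrow> odd ((c + of_bool h') mod 2 - (a + of_bool h) mod 2)"
      by metis
    then show ?thesis by (cases h; cases h'; cases "even a"; simp)
  qed
  show ?thesis
    unfolding adj R_conn_iff[OF x y] using x0 xn px py pq by auto
qed

text \<open>Twice \<open>n\<close> vanishes modulo \<open>2 * n\<close>, so the shift by
  \<open>n\<close> is an involution; it exchanges the lower and upper halves of the columns, and
  \<open>T\<close> is the lower one.\<close>

lemma matched_columns_R_graph:
  assumes n: "n \<ge> 1"
  shows "matched_columns (R_graph n) {0..<2 * int n} {0..<int n}
    (\<lambda>a. (a + int n) mod (2 * int n)) R_vertex"
proof
  show "{0..<2 * int n} \<noteq> {}" using n by simp
next
  fix a assume a: "a \<in> {0..<2 * int n}"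
  show "(a + int n) mod (2 * int n) \<in> {0..<2 * int n}" using n by simp
  have "(a + int n) mod (2 * int n) = (if a < int n then a + int n else a - int n)"
    using a by (auto simp: mod_pos_pos_trivial intro!: int_mod_pos_eq[where q = 1])
  then show "(a + int n) mod (2 * int n) \<in> {0..<int n} \<longleftrightarrow> a \<notin> {0..<int n}"
    using a by auto
  show "((a + int n) mod (2 * int n) + int n) mod (2 * int n) = a"
    using a by (simp add: mod_add_left_eq add.assoc)
next
  show "pverts (R_graph n) = {R_vertex a s h |a s h. a \<in> {0..<2 * int n}}"
  proof (intro equalityI subsetI)
    fix v assume "v \<in> pverts (R_graph n)"
    then obtain a b where v: "v = (a, b)" "a \<in> {0..<2 * int n}" "b \<in> {0..<4}"
      using n by (auto simp: pverts_R_graph)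
    have "v = R_vertex a (odd b) (odd (a + b div 2))"
    proof -
      have "(a + of_bool (odd (a + b div 2))) mod 2 = b div 2"
      proof -
        have "b div 2 = 0 \<or> b div 2 = 1" using v(3) by auto
        then show ?thesis by (auto simp: mod_2_eq_odd)
      qed
      then show ?thesis
        unfolding R_vertex_def v(1) by (simp only: mod_2_eq_odd[symmetric] mod_mult_div_eq)
    qed
    with v show "v \<in> {R_vertex a s h |a s h. a \<in> {0..<2 * int n}}" by blast
  qed (use n in \<open>auto simp: R_vertex_def pverts_R_graph\<close>)
next
  show "parcs (R_graph n) \<subseteq> pverts (R_graph n) \<times> pverts (R_graph n)"
    by (auto simp: R_graph_def cayley_graph_def)
next
  fix a a' s h s' h'
  show "R_vertex a s h = R_vertex a' s' h' \<longleftrightarrow> a = a' \<and> s = s' \<and> h = h'"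
  proof
    assume eq: "R_vertex a s h = R_vertex a' s' h'"
    then have [simp]: "a' = a" by (simp add: R_vertex_def)
    have *: "of_bool s + 2 * ((a + of_bool h) mod 2) = of_bool s' + 2 * ((a + of_bool h') mod 2)"
      using eq by (simp add: R_vertex_def)
    \<comment> \<open>The parity of the second coordinate determines the side; with the side
      cancelled, the parity of \<open>a + of_bool h\<close> determines the half.\<close>
    from arg_cong[OF *, of even] have [simp]: "s' = s" by (cases s; cases s'; simp)
    from * have "(a + of_bool h) mod 2 = (a + of_bool h') mod 2" by simp
    from arg_cong[OF this, of even] show "a = a' \<and> s = s' \<and> h = h'" by auto
  qed simp
qed (use R_vertex_adj[OF n] in simp_all)

theorem proposition3p6:
  fixes n :: nat
  assumes "n \<ge> 2"
  shows "pair_graph (R_graph n)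
    \<and> Digraph_Component.connected (R_graph n)
    \<and> CIS (R_graph n)
    \<and> card (verts (R_graph n)) = 8 * n
    \<and> has_valency (R_graph n) (2 * n + 3)
    \<and> stability_number (R_graph n) = 2 * n
    \<and> clique_number (R_graph n) = 4"
proof -
  interpret matched_columns "R_graph n" "{0..<2 * int n}" "{0..<int n}"
    "\<lambda>a. (a + int n) mod (2 * int n)" R_vertex
    using assms by (intro matched_columns_R_graph) simp
  have "card {0..<2 * int n} = 2 * n" by simp
  then show ?thesis
    using pair_graph connected CIS card_pverts has_valency stability_number clique_number
    by simp
qed

end
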